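(* Let $\beta\in(0,2)\setminus\{1\}$ and let $(Z_t)_{t\ge 0}$ be a family of $\mathbb{R}$-valued random variables with distribution functions $(F_t)_{t\ge 0}$ whose Laplace--Stieltjes transforms $\hat F_t(s)=\int_{-\infty}^{\infty}e^{-sx}\,\mathrm{d}F_t(x)$ satisfy $$\hat F_t(s)=1-\Gamma(1-\beta)\,L_t(1/s)\,s^{\beta}+\mathcal{E}_t(s),\qquad s\ge 0,$$ where $(L_t)_{t\ge0}\in\mathcal{L}^+_{\mathrm{sep}}$ and, for each fixed $t$, $\mathcal{E}_t(s)=o(L_t(1/s)s^{\beta})$ as $s\to 0^+$. Assume that $Z_t\ge 0$ for all $t$ if $\beta\in(0,1)$. Let $(s_t)_{t\ge0}$ be such that $s_t>0$ for all $t$, $s_t\to0$ as $t\to\infty$, and for every $\lambda>0$ $$\lim_{t\to\infty}\ \sup_{s\in(0,\lambda s_t]}\frac{|\mathcal{E}_t(s)|}{L_t(1/s)\,s^{\beta}}=0 .$$ Then, for $x_t:=1/s_t$, $$\lim_{t\to\infty}\ \sup_{x\ge x_t}\left|\frac{\mathbb{P}[Z_t>x]}{L_t(x)\,x^{-\beta}}-1\right|=0 .$$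
   Context: A function $\ell$ is slowly varying at infinity if $\lim_{x\to\infty}\ell(\Lambda x)/\ell(x)=1$ for every $\Lambda>0$. The class $\mathcal{L}^+_{\mathrm{sep}}$ consists of the families of separable functions $L_t(x)=c_t\,\ell(x)$, where $(c_t)_{t\ge0}$ is a family of eventually (in $t$) positive constants and $\ell$ is an eventually positive function slowly varying at infinity. By convention (without loss of generality, replacing $\ell$ by an asymptotically equivalent function), for every $\alpha>0$ the function $x\mapsto x^{\alpha}\ell(x)$ is eventually non-decreasing. $\Gamma$ denotes the Gamma function (so $\Gamma(1-\beta)<0$ for $\beta\in(1,2)$). At $s=0$ the expansion is understood as $\hat F_t(0)=1$. *)

theory Defs
  imports "HOL-Probability.Probability" "HOL-Library.Landau_Symbols"
begin

definition slowly_varying :: "(real \<Rightarrow> real) \<Rightarrow> bool" where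
  "slowly_varying l \<longleftrightarrow> (\<forall>\<Lambda>>0. ((\<lambda>x. l (\<Lambda> * x) / l x) \<longlongrightarrow> 1) at_top)"

text \<open>
  Families are indexed by the reals \<open>t \<ge> 0\<close> and their members are functions on \<open>x > 0\<close>; values
  elsewhere are irrelevant. The last conjunct is the standing convention on the choice of the
  slowly varying factor.
\<close>

definition L_sep_pos :: "(real \<Rightarrow> real \<Rightarrow> real) set" where
  "L_sep_pos = {L. \<exists>c l.
     (\<forall>t\<ge>0. \<forall>x>0. L t x = c t * l x) \<and>
     (\<forall>\<^sub>F t in at_top. c t > 0) \<and>
     (\<forall>\<^sub>F x in at_top. l x > 0) \<and>
     slowly_varying l \<and>
     (\<forall>\<alpha>>0. \<exists>X. mono_on {X..} (\<lambda>x. x powr \<alpha> * l x))}"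

text \<open>
  \<open>interval_measure F\<close> is the Lebesgue--Stieltjes measure of \<open>F\<close>. The Bochner integral is 0 when
  the integrand is not integrable, so finiteness has to be assumed separately where it is needed.
\<close>

definition laplace_stieltjes :: "(real \<Rightarrow> real) \<Rightarrow> real \<Rightarrow> real" where
  "laplace_stieltjes F s = (LINT x|interval_measure F. exp (- s * x))"

lemma (in prob_space) laplace_stieltjes_cdf:
  assumes [measurable]: "random_variable borel X"
  shows "laplace_stieltjes (cdf (distr M borel X)) s = expectation (\<lambda>\<omega>. exp (- s * X \<omega>))"
proof -
  interpret D: real_distribution "distr M borel X"
    by (rule real_distribution_distr) fact
  have "interval_measure (cdf (distr M borel X)) = distr M borel X"
    by (intro cdf_unique real_distribution_interval_measure cdf_interval_measure
          D.real_distribution_axioms D.cdf_nondecreasing D.cdf_is_right_cont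
          D.cdf_lim_at_bot D.cdf_lim_at_top_prob)
  then show ?thesis
    by (simp add: laplace_stieltjes_def integral_distr)
qed

end

theory Submission
  imports Defs "HOL-Real_Asymp.Real_Asymp"
begin

text \<open>
  Along sequences \<open>t\<^sub>n \<rightarrow> \<infinity>\<close>, \<open>x\<^sub>n \<ge> 1 / s t\<^sub>n\<close>, put \<open>X\<^sub>n = Z\<^sub>t\<^sub>n / x\<^sub>n\<close> and \<open>a\<^sub>n = L\<^sub>t\<^sub>n(x\<^sub>n) x\<^sub>n powr (- \<beta>)\<close>;
  slow variation gives \<open>(E exp (- k X\<^sub>n) - 1) / a\<^sub>n \<rightarrow> - \<Gamma>(1 - \<beta>) k powr \<beta>\<close> for each natural \<open>k\<close>.
  Taking second differences in \<open>k\<close> treats \<open>\<beta> < 1\<close> and \<open>\<beta> > 1\<close> alike: the numbers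
  \<open>E[(1 - exp (- X\<^sub>n))\<^sup>2 exp (- k X\<^sub>n)] / a\<^sub>n\<close> converge to the moments, in the variable \<open>exp (- z)\<close>, of
  the finite measure \<open>(1 - exp (- z))\<^sup>2 \<beta> z powr (- \<beta> - 1) dz\<close> on \<open>z > 0\<close>. The part of \<open>X\<^sub>n \<le> 0\<close> is
  negligible because, by Bernoulli's inequality, it is at most \<open>m powr (- 2)\<close> times a quantity of
  order \<open>m powr \<beta>\<close> with \<open>\<beta> < 2\<close>. As in Karamata's argument, polynomials are then replaced by
  continuous functions and these by the indicator of \<open>z > 1\<close>, whose limit mass is \<open>1\<close>.
\<close>

section \<open>Moments of the limit measure\<close>

lemma has_bochner_integral_of_has_integral_nonneg:
  fixes f :: "real \<Rightarrow> real"
  assumes [measurable]: "f \<in> borel_measurable borel" "S \<in> sets borel"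
    and nn: "\<And>x. x \<in> S \<Longrightarrow> 0 \<le> f x" and I: "(f has_integral r) S"
  shows "has_bochner_integral lborel (\<lambda>x. indicator S x * f x) r"
proof (rule has_bochner_integral_nn_integral)
  show "0 \<le> r" using has_integral_nonneg[OF I] nn by auto
  show "(\<integral>\<^sup>+ x. ennreal (indicator S x * f x) \<partial>lborel) = ennreal r"
    by (rule nn_integral_has_integral_lebesgue[OF nn I])
qed (auto simp: indicator_def nn)

lemma laplace_powr:
  fixes g j :: real
  assumes "g > 0" "j > 0"
  shows "has_bochner_integral lborel
    (\<lambda>z. indicator {0<..} z * (z powr (g - 1) * exp (- j * z))) (Gamma g * j powr (- g))"
proof -
  have "has_bochner_integral lborel
      (\<lambda>t. indicator {0..} t * (t powr (g - 1) / exp t)) (Gamma g)"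
    by (rule has_bochner_integral_of_has_integral_nonneg[OF _ _ _ Gamma_integral_real])
       (use assms in auto)
  then have "has_bochner_integral lborel
      (\<lambda>z. indicator {0..} (0 + j * z) * ((0 + j * z) powr (g - 1) / exp (0 + j * z))) (Gamma g /\<^sub>R \<bar>j\<bar>)"
    using assms by (subst (asm) lborel_has_bochner_integral_real_affine_iff[of j _ _ 0]) auto
  then have "has_bochner_integral lborel
      (\<lambda>z. j powr (1 - g) * (indicator {0..} (0 + j * z) * ((0 + j * z) powr (g - 1) / exp (0 + j * z))))
      (j powr (1 - g) * (Gamma g /\<^sub>R \<bar>j\<bar>))"
    by (rule has_bochner_integral_mult_right)
  \<comment> \<open>The factor \<open>j powr (1 - g)\<close> cancels the power of \<open>j\<close>
    produced by the substitution. At \<open>z = 0\<close> the closed and the open half-line agree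
    because \<open>0 powr (g - 1) = 0\<close>.\<close>
  also have "(\<lambda>z. j powr (1 - g) * (indicator {0..} (0 + j * z) * ((0 + j * z) powr (g - 1) / exp (0 + j * z))))
     = (\<lambda>z. indicator {0<..} z * (z powr (g - 1) * exp (- j * z)))"
  proof
    fix z :: real
    have "j powr (1 - g) * j powr (g - 1) = 1"
      using assms by (simp add: powr_add [symmetric])
    then show "j powr (1 - g) * (indicator {0..} (0 + j * z) * ((0 + j * z) powr (g - 1) / exp (0 + j * z)))
       = indicator {0<..} z * (z powr (g - 1) * exp (- j * z))"
      using assms by (auto simp: indicator_def powr_mult exp_minus field_simps zero_le_mult_iff)
  qed
  also have "j powr (1 - g) * (Gamma g /\<^sub>R \<bar>j\<bar>) = Gamma g * j powr (- g)"
    using assms by (simp add: powr_diff powr_minus field_simps)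
  finally show ?thesis .
qed

text \<open>The three exponentials of the second difference cannot be integrated one by one, since
  \<open>z powr (- \<beta> - 1)\<close> is not integrable at 0. Two integrations by parts raise the
  exponent to \<open>1 - \<beta> > -1\<close>, where each exponential yields
  \<open>Gamma (2 - \<beta>)\<close>, and the functional equation of Gamma cancels the divisor
  \<open>1 - \<beta>\<close>.\<close>

lemma second_difference_integral:
  fixes k \<beta> :: real
  assumes \<beta>: "0 < \<beta>" "\<beta> < 2" "\<beta> \<noteq> 1" and k: "k \<ge> 0"
  shows "has_bochner_integral lborel
    (\<lambda>z. indicator {0<..} z * ((1 - exp (- z))\<^sup>2 * exp (- k * z) * (\<beta> * z powr (- \<beta> - 1))))
    (- Gamma (1 - \<beta>) * ((k + 2) powr \<beta> - 2 * (k + 1) powr \<beta> + k powr \<beta>))"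
proof -
  define h where "h z = (1 - exp (- z))\<^sup>2 * exp (- k * z) * (\<beta> * z powr (- \<beta> - 1))" for z :: real
  define q where "q z = (k\<^sup>2 * exp (- k * z) - 2 * (k + 1)\<^sup>2 * exp (- (k + 1) * z)
      + (k + 2)\<^sup>2 * exp (- (k + 2) * z)) * (z powr (1 - \<beta>) / (1 - \<beta>))" for z :: real
  define W where "W z = - ((1 - exp (- z))\<^sup>2 * exp (- k * z) * z powr (- \<beta>))
      + exp (- k * z) * (2 * exp (- z) - k * (1 - exp (- z))) *
        ((1 - exp (- z)) * z powr (1 - \<beta>)) / (1 - \<beta>)" for z :: real

  \<comment> \<open>\<open>W\<close> is the boundary term of two integrations by parts; \<open>h + q\<close> is its derivative.\<close>
  have J: "has_bochner_integral lborel
      (\<lambda>z. indicator {0<..} z * (j\<^sup>2 * exp (- j * z) * z powr (1 - \<beta>))) (Gamma (2 - \<beta>) * j powr \<beta>)"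
    if "j \<ge> 0" for j
  \<comment> \<open>The case \<open>j = 0\<close> arises from \<open>k = 0\<close>; both sides
    vanish there, as \<open>0 powr \<beta> = 0\<close>.\<close>
  proof (cases "j = 0")
    case False
    then have "j > 0" using that by simp
    have "has_bochner_integral lborel
        (\<lambda>z. j\<^sup>2 * (indicator {0<..} z * (z powr (2 - \<beta> - 1) * exp (- j * z))))
        (j\<^sup>2 * (Gamma (2 - \<beta>) * j powr (- (2 - \<beta>))))"
      by (intro has_bochner_integral_mult_right laplace_powr) (use \<open>j > 0\<close> \<beta> in auto)
    moreover have "j\<^sup>2 * (Gamma (2 - \<beta>) * j powr (- (2 - \<beta>))) = Gamma (2 - \<beta>) * j powr \<beta>"
      using \<open>j > 0\<close> by (simp add: powr_diff powr_minus field_simps)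
    ultimately show ?thesis by (simp only:) (simp add: mult_ac)
  qed (simp add: has_bochner_integral_zero)
  have "has_bochner_integral lborel
      (\<lambda>z. (indicator {0<..} z * (k\<^sup>2 * exp (- k * z) * z powr (1 - \<beta>))
        - 2 * (indicator {0<..} z * ((k+1)\<^sup>2 * exp (- (k+1) * z) * z powr (1 - \<beta>)))
        + indicator {0<..} z * ((k+2)\<^sup>2 * exp (- (k+2) * z) * z powr (1 - \<beta>))) / (1 - \<beta>))
      ((Gamma (2 - \<beta>) * k powr \<beta> - 2 * (Gamma (2 - \<beta>) * (k+1) powr \<beta>)
        + Gamma (2 - \<beta>) * (k+2) powr \<beta>) / (1 - \<beta>))"
    by (intro has_bochner_integral_divide_zero has_bochner_integral_add has_bochner_integral_diff
          has_bochner_integral_mult_right J) (use k in auto)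
  moreover have "Gamma (2 - \<beta>) = (1 - \<beta>) * Gamma (1 - \<beta>)"
  proof -
    have "1 - \<beta> \<notin> \<int>\<^sub>\<le>\<^sub>0"
    proof
      assume "1 - \<beta> \<in> \<int>\<^sub>\<le>\<^sub>0"
      then obtain i :: nat where "1 - \<beta> = - of_nat i" by (elim nonpos_Ints_cases')
      then have "\<beta> = real (Suc i)" by simp
      with \<beta> show False by (cases i) auto
    qed
    from Gamma_plus1[OF this] show ?thesis by (simp add: algebra_simps)
  qed
  moreover have "(G * k powr \<beta> - 2 * (G * (k+1) powr \<beta>) + G * (k+2) powr \<beta>) / (1 - \<beta>)
      = Gamma (1 - \<beta>) * ((k + 2) powr \<beta> - 2 * (k + 1) powr \<beta> + k powr \<beta>)"
    if "G = (1 - \<beta>) * Gamma (1 - \<beta>)" for G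
    using \<beta> by (simp add: that divide_simps) (simp add: algebra_simps)
  moreover have "indicator {0<..} z * q z = (indicator {0<..} z * (k\<^sup>2 * exp (- k * z) * z powr (1 - \<beta>))
        - 2 * (indicator {0<..} z * ((k+1)\<^sup>2 * exp (- (k+1) * z) * z powr (1 - \<beta>)))
        + indicator {0<..} z * ((k+2)\<^sup>2 * exp (- (k+2) * z) * z powr (1 - \<beta>))) / (1 - \<beta>)" for z
    using \<beta> by (simp add: q_def divide_simps) (simp add: algebra_simps)
  ultimately have q: "has_bochner_integral lborel (\<lambda>z. indicator {0<..} z * q z)
      (Gamma (1 - \<beta>) * ((k + 2) powr \<beta> - 2 * (k + 1) powr \<beta> + k powr \<beta>))"
    by simp

  have qi: "integrable lborel (\<lambda>z. indicator {0<..} z * q z)"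
    using q by (simp add: has_bochner_integral_iff)

  \<comment> \<open>The first bound serves near 0, where it leaves
    \<open>z powr (1 - \<beta>)\<close>, the second one near infinity, where it leaves
    \<open>z powr (- \<beta> - 1)\<close>; splitting at 1 gives an integrable majorant of
    \<open>h\<close>.\<close>
  have le: "(1 - exp (- z))\<^sup>2 * exp (- k * z) \<le> z\<^sup>2" "(1 - exp (- z))\<^sup>2 * exp (- k * z) \<le> 1"
    if "z > 0" for z
  proof -
    have "0 \<le> 1 - exp (- z)" "1 - exp (- z) \<le> z" using that exp_ge_add_one_self[of "-z"] by auto
    then have "(1 - exp (- z))\<^sup>2 \<le> z\<^sup>2" "(1 - exp (- z))\<^sup>2 \<le> 1"
      by (auto intro: power_mono simp: abs_square_le_1)
    moreover have "exp (- k * z) \<le> 1" using that k by simp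
    ultimately show "(1 - exp (- z))\<^sup>2 * exp (- k * z) \<le> z\<^sup>2"
      "(1 - exp (- z))\<^sup>2 * exp (- k * z) \<le> 1"
      by (metis exp_ge_zero mult_left_le order_trans zero_le_power2)+
  qed
  have "has_bochner_integral lborel
      (\<lambda>z. indicator {0..1} z * z powr (1 - \<beta>)) (1 powr (1 - \<beta> + 1) / (1 - \<beta> + 1))"
    by (rule has_bochner_integral_of_has_integral_nonneg[OF _ _ _ has_integral_powr_from_0])
       (use \<beta> in auto)
  moreover have "has_bochner_integral lborel
      (\<lambda>z. indicator {1..} z * z powr (- \<beta> - 1)) (- (1 powr (- \<beta> - 1 + 1)) / (- \<beta> - 1 + 1))"
    by (rule has_bochner_integral_of_has_integral_nonneg[OF _ _ _ has_integral_powr_to_inf])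
       (use \<beta> in auto)
  ultimately have "integrable lborel (\<lambda>z. \<beta> * (indicator {0..1} z * z powr (1 - \<beta>)
      + indicator {1..} z * z powr (- \<beta> - 1)))"
    by (auto simp: has_bochner_integral_iff)
  then have hi: "integrable lborel (\<lambda>z. indicator {0<..} z * h z)"
  proof (rule Bochner_Integration.integrable_bound)
    show "(\<lambda>z. indicator {0<..} z * h z) \<in> borel_measurable lborel"
      unfolding h_def by measurable
    show "AE z in lborel. norm (indicator {0<..} z * h z) \<le> norm (\<beta> * (indicator {0..1} z * z powr (1 - \<beta>)
      + indicator {1..} z * z powr (- \<beta> - 1)))"
    proof (rule AE_I2)
      fix z :: real
      have pw: "z\<^sup>2 * z powr (- \<beta> - 1) = z powr (1 - \<beta>)" if "z > 0"
        using that by (simp add: powr_diff powr_minus field_simps power2_eq_square)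
      have "h z \<le> \<beta> * z powr (1 - \<beta>)" if "z > 0"
        using mult_right_mono[OF le(1)[OF that], of "\<beta> * z powr (- \<beta> - 1)"] pw[OF that] \<beta>
        by (simp add: h_def algebra_simps)
      moreover have "h z \<le> \<beta> * z powr (- \<beta> - 1)" if "z > 0"
        using mult_right_mono[OF le(2)[OF that], of "\<beta> * z powr (- \<beta> - 1)"] \<beta>
        by (simp add: h_def algebra_simps)
      moreover have "0 \<le> h z" using \<beta> by (simp add: h_def)
      moreover have "0 \<le> \<beta> * z powr (1 - \<beta>)" "0 \<le> \<beta> * z powr (- \<beta> - 1)" using \<beta> by auto
      ultimately show "norm (indicator {0<..} z * h z) \<le> norm (\<beta> * (indicator {0..1} z * z powr (1 - \<beta>)
          + indicator {1..} z * z powr (- \<beta> - 1)))"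
        by (auto simp: indicator_def distrib_left abs_of_nonneg)
    qed
  qed

  \<comment> \<open>The two zeros are the limits of \<open>W\<close> at infinity and at 0, so the
    integral of \<open>h\<close> is minus that of \<open>q\<close>.\<close>
  have "(LBINT z=0..\<infinity>. h z + q z) = 0 - 0"
  proof (rule interval_integral_FTC_integrable)
    fix z :: real assume "0 < ereal z" then have z: "z > 0" by simp
    define a b where "a = exp (- z)" and "b = exp (- k * z)"
    have ab: "exp (- (k + 1) * z) = a * b" "exp (- (k + 2) * z) = a\<^sup>2 * b"
      by (simp_all add: a_def b_def algebra_simps power2_eq_square flip: exp_add)
    have A: "((\<lambda>z. (1 - exp (- z))\<^sup>2 * exp (- k * z)) has_real_derivative
        b * (2 * a - k * (1 - a)) * (1 - a)) (at z)"
      by (auto intro!: derivative_eq_intros simp: a_def b_def algebra_simps power2_eq_square)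
    have B: "((\<lambda>z. exp (- k * z) * (2 * exp (- z) - k * (1 - exp (- z))) * (1 - exp (- z)))
        has_real_derivative (k\<^sup>2 * b - 2 * (k + 1)\<^sup>2 * (a * b) + (k + 2)\<^sup>2 * (a\<^sup>2 * b))) (at z)"
      by (auto intro!: derivative_eq_intros simp: a_def b_def algebra_simps power2_eq_square)
    have P: "((\<lambda>z. z powr (- \<beta>)) has_real_derivative - \<beta> * z powr (- \<beta> - 1)) (at z)"
      "((\<lambda>z. z powr (1 - \<beta>)) has_real_derivative (1 - \<beta>) * z powr (1 - \<beta> - 1)) (at z)"
      by (rule has_real_derivative_powr[OF z])+
    have WAB: "W = (\<lambda>z. - ((1 - exp (- z))\<^sup>2 * exp (- k * z) * z powr (- \<beta>)) +
        exp (- k * z) * (2 * exp (- z) - k * (1 - exp (- z))) * (1 - exp (- z)) * z powr (1 - \<beta>) / (1 - \<beta>))"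
      by (simp add: W_def fun_eq_iff mult.assoc)
    have "(W has_real_derivative h z + q z) (at z)"
      unfolding WAB
      by (rule DERIV_cong[OF DERIV_add[OF DERIV_minus[OF DERIV_mult[OF A P(1)]]
            DERIV_cdivide[OF DERIV_mult[OF B P(2)]]]])
         (unfold h_def q_def ab, fold a_def b_def, use \<beta> in \<open>simp add: divide_simps\<close>,
          simp add: algebra_simps)
    then show "(W has_vector_derivative h z + q z) (at z)"
      by (simp add: has_real_derivative_iff_has_vector_derivative)
    show "isCont (\<lambda>z. h z + q z) z"
      unfolding h_def q_def using z \<beta> by (auto intro!: continuous_intros)
  next
    show "set_integrable lborel (einterval 0 \<infinity>) (\<lambda>z. h z + q z)"
      using Bochner_Integration.integrable_add[OF hi qi]
      by (simp add: set_integrable_def einterval_def greaterThan_def algebra_simps)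
  next
    \<comment> \<open>Both terms of \<open>W\<close> are of order
      \<open>z powr (2 - \<beta>)\<close> at 0. If \<beta> > 1, then
      \<open>z powr (1 - \<beta>)\<close> alone blows up, so it is kept together with the factor
      \<open>1 - exp (- z)\<close>, which is worth one power of \<open>z\<close>.\<close>
    have 1: "((\<lambda>z. (1 - exp (- z))\<^sup>2 * exp (- k * z) * z powr (- \<beta>)) \<longlongrightarrow> 0) (at_right 0)"
      using \<beta> by real_asymp
    have 2: "((\<lambda>z. (1 - exp (- z)) * z powr (1 - \<beta>)) \<longlongrightarrow> 0) (at_right 0)"
    proof (rule Lim_transform_eventually)
      have "((\<lambda>z::real. (1 - exp (- z)) / z) \<longlongrightarrow> 1) (at_right 0)" by real_asymp
      moreover have "((\<lambda>z::real. z powr (2 - \<beta>)) \<longlongrightarrow> 0) (at_right 0)" using \<beta> by real_asymp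
      ultimately show "((\<lambda>z. (1 - exp (- z)) / z * z powr (2 - \<beta>)) \<longlongrightarrow> 0) (at_right 0)"
        using tendsto_mult by fastforce
      show "\<forall>\<^sub>F z in at_right 0. (1 - exp (- z)) / z * z powr (2 - \<beta>) = (1 - exp (- z)) * z powr (1 - \<beta>)"
        using eventually_at_right_less[of 0]
        by eventually_elim (simp add: powr_diff power2_eq_square)
    qed
    have "(W \<longlongrightarrow> - 0 + exp (- k * 0) * (2 * exp (- 0) - k * (1 - exp (- 0))) * 0 / (1 - \<beta>)) (at_right 0)"
      unfolding W_def by (intro tendsto_intros 1 2) (use \<beta> in auto)
    then show "((W \<circ> real_of_ereal) \<longlongrightarrow> 0) (at_right 0)"
      by (simp add: ereal_tendsto_simps zero_ereal_def)
    have "(W \<longlongrightarrow> 0) at_top"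
    \<comment> \<open>Without the damping \<open>exp (- k * z)\<close>, the first term decays
      through \<open>z powr (- \<beta>)\<close> and the second through its factor
      \<open>2 * exp (- z)\<close>.\<close>
    proof (cases "k = 0")
      case True
      have 1: "((\<lambda>z. (1 - exp (- z))\<^sup>2 * z powr (- \<beta>)) \<longlongrightarrow> 0) at_top"
        using \<beta> by real_asymp
      have 2: "((\<lambda>z. 2 * exp (- z) * ((1 - exp (- z)) * z powr (1 - \<beta>))) \<longlongrightarrow> 0) at_top"
        using \<beta> by real_asymp
      have "(W \<longlongrightarrow> - 0 + 0 / (1 - \<beta>)) at_top"
        unfolding W_def using True tendsto_add[OF tendsto_minus[OF 1] tendsto_divide[OF 2 tendsto_const[of "1 - \<beta>"]]] \<beta>
        by simp
      then show ?thesis by simp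
    next
      case False
      then have "k > 0" using k by simp
      then have 1: "((\<lambda>z. (1 - exp (- z))\<^sup>2 * exp (- k * z) * z powr (- \<beta>)) \<longlongrightarrow> 0) at_top"
        using \<beta> by real_asymp
      have 2: "((\<lambda>z. exp (- k * z) * (2 * exp (- z) - k * (1 - exp (- z))) *
          ((1 - exp (- z)) * z powr (1 - \<beta>))) \<longlongrightarrow> 0) at_top"
        using \<beta> \<open>k > 0\<close> by real_asymp
      have "(W \<longlongrightarrow> - 0 + 0 / (1 - \<beta>)) at_top"
        unfolding W_def by (intro tendsto_intros 1 2) (use \<beta> in auto)
      then show ?thesis by simp
    qed
    then show "((W \<circ> real_of_ereal) \<longlongrightarrow> 0) (at_left \<infinity>)"
      by (simp add: ereal_tendsto_simps)
  qed auto
  then have "(\<integral>z. indicator {0<..} z * h z + indicator {0<..} z * q z \<partial>lborel) = 0"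
    by (simp add: interval_lebesgue_integral_def set_lebesgue_integral_def einterval_def
        greaterThan_def algebra_simps)
  then have "(\<integral>z. indicator {0<..} z * h z \<partial>lborel) = - (\<integral>z. indicator {0<..} z * q z \<partial>lborel)"
    using hi qi by simp
  with hi has_bochner_integral_integral_eq[OF q] show ?thesis
    by (simp add: has_bochner_integral_iff h_def)
qed

section \<open>From moments to continuous test functions\<close>

text \<open>By Weierstrass, \<open>g\<close> is uniformly close to a polynomial on the unit
  interval, and the error after integration is at most that distance times the total mass. The
  moment of order 0 keeps the masses bounded. Confining \<open>Y\<close> and \<open>V\<close> only
  where the weights are nonzero allows \<open>exp (- X)\<close> to exceed 1 on the event that a
  weight cuts off.\<close>

lemma weighted_moments_imp_continuous:
  fixes w Y :: "nat \<Rightarrow> 'a \<Rightarrow> real" and v V :: "'b \<Rightarrow> real" and g :: "real \<Rightarrow> real"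
  assumes [measurable]: "\<And>n. Y n \<in> borel_measurable M" "V \<in> borel_measurable K"
    and w: "\<And>n. integrable M (w n)" "\<And>n x. 0 \<le> w n x" "\<And>n x. w n x \<noteq> 0 \<Longrightarrow> Y n x \<in> {0..1}"
    and v: "integrable K v" "\<And>x. 0 \<le> v x" "\<And>x. v x \<noteq> 0 \<Longrightarrow> V x \<in> {0..1}"
    and moments: "\<And>k. (\<lambda>n. \<integral>x. w n x * Y n x ^ k \<partial>M) \<longlonglongrightarrow> (\<integral>x. v x * V x ^ k \<partial>K)"
    and g: "continuous_on UNIV g"
  shows "(\<lambda>n. \<integral>x. w n x * g (Y n x) \<partial>M) \<longlonglongrightarrow> (\<integral>x. v x * g (V x) \<partial>K)"
proof -
  have bdd: "\<exists>B. \<forall>x\<in>{0..1}. \<bar>f x\<bar> \<le> B" if "continuous_on UNIV f" for f :: "real \<Rightarrow> real"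
  proof -
    have "compact (f ` {0..1})"
      by (rule compact_continuous_image) (use that continuous_on_subset in auto)
    from compact_imp_bounded[OF this] show ?thesis by (auto simp: bounded_iff)
  qed
  \<comment> \<open>A bound for \<open>f\<close> on the unit interval is enough, as the weight
    vanishes wherever \<open>Y\<close> leaves it.\<close>
  have intM: "integrable M (\<lambda>x. w n x * f (Y n x))" if "continuous_on UNIV f" for f n
  proof -
    have [measurable]: "f \<in> borel_measurable borel"
      using that by (simp add: borel_measurable_continuous_onI)
    note [measurable] = borel_measurable_integrable[OF w(1)]
    from bdd[OF that] obtain B where "\<forall>x\<in>{0..1}. \<bar>f x\<bar> \<le> B" by auto
    then have "\<bar>w n x * f (Y n x)\<bar> \<le> \<bar>B * w n x\<bar>" for x
      using w(2,3)[of n x] by (cases "w n x = 0") (auto simp: abs_mult intro!: mult_mono intro: order_trans[OF _ abs_ge_self])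
    then show ?thesis
      by (intro Bochner_Integration.integrable_bound[OF integrable_mult_right[of B, OF w(1)]]) auto
  qed
  have intK: "integrable K (\<lambda>x. v x * f (V x))" if "continuous_on UNIV f" for f
  proof -
    have [measurable]: "f \<in> borel_measurable borel"
      using that by (simp add: borel_measurable_continuous_onI)
    note [measurable] = borel_measurable_integrable[OF v(1)]
    from bdd[OF that] obtain B where "\<forall>x\<in>{0..1}. \<bar>f x\<bar> \<le> B" by auto
    then have "\<bar>v x * f (V x)\<bar> \<le> \<bar>B * v x\<bar>" for x
      using v(2,3)[of x] by (cases "v x = 0") (auto simp: abs_mult intro!: mult_mono intro: order_trans[OF _ abs_ge_self])
    then show ?thesis
      by (intro Bochner_Integration.integrable_bound[OF integrable_mult_right[of B, OF v(1)]]) auto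
  qed
  define m where "m = (\<integral>x. v x \<partial>K)"
  have mass: "(\<lambda>n. \<integral>x. w n x \<partial>M) \<longlonglongrightarrow> m" using moments[of 0] by (simp add: m_def)
  have "m \<ge> 0" unfolding m_def using v by (simp add: Bochner_Integration.integral_nonneg)
  show ?thesis
  proof (rule LIMSEQ_I)
    fix r :: real assume "r > 0"
    \<comment> \<open>The errors are \<open>e * (m + 1)\<close> for replacing \<open>g\<close> under
      \<open>M\<close>, where the mass is eventually below \<open>m + 1\<close>, then
      \<open>e\<close> for the convergence of the polynomial integrals, and \<open>e * m\<close>
      under \<open>K\<close>. They add up to \<open>e * (2 * m + 2)\<close>.\<close>
    define e where "e = r / (2 * m + 3)"
    have e: "e > 0" "e * (2 * m + 2) < r" using \<open>r > 0\<close> \<open>m \<ge> 0\<close> by (auto simp: e_def field_simps)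
    obtain p where p: "real_polynomial_function p" and gp: "\<And>x. x \<in> {0..1} \<Longrightarrow> \<bar>g x - p x\<bar> < e"
      using Stone_Weierstrass_real_polynomial_function[of "{0..1::real}" g e] g e
      by (metis compact_Icc continuous_on_subset subset_UNIV)
    obtain c d where pd: "p = (\<lambda>x. \<Sum>i\<le>d. c i * x ^ i)"
      using p by (auto simp: real_polynomial_function_iff_sum)
    have pc: "continuous_on UNIV p" unfolding pd by (intro continuous_intros)
    have powc: "continuous_on UNIV (\<lambda>x::real. x ^ i)" for i by (intro continuous_intros)
    have pM: "(\<integral>x. w n x * p (Y n x) \<partial>M) = (\<Sum>i\<le>d. c i * (\<integral>x. w n x * Y n x ^ i \<partial>M))" for n
    proof -
      have "(\<integral>x. w n x * p (Y n x) \<partial>M) = (\<integral>x. (\<Sum>i\<le>d. c i * (w n x * Y n x ^ i)) \<partial>M)"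
        by (simp add: pd sum_distrib_left mult.left_commute)
      then show ?thesis using intM[OF powc] by simp
    qed
    have pK: "(\<integral>x. v x * p (V x) \<partial>K) = (\<Sum>i\<le>d. c i * (\<integral>x. v x * V x ^ i \<partial>K))"
    proof -
      have "(\<integral>x. v x * p (V x) \<partial>K) = (\<integral>x. (\<Sum>i\<le>d. c i * (v x * V x ^ i)) \<partial>K)"
        by (simp add: pd sum_distrib_left mult.left_commute)
      then show ?thesis using intK[OF powc] by simp
    qed
    have "(\<lambda>n. \<integral>x. w n x * p (Y n x) \<partial>M) \<longlonglongrightarrow> (\<integral>x. v x * p (V x) \<partial>K)"
      unfolding pM pK by (intro tendsto_intros moments)
    from LIMSEQ_D[OF this e(1)] obtain n1 where n1:
      "\<And>n. n \<ge> n1 \<Longrightarrow> \<bar>(\<integral>x. w n x * p (Y n x) \<partial>M) - (\<integral>x. v x * p (V x) \<partial>K)\<bar> < e" by auto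
    from LIMSEQ_D[OF mass, of 1] obtain n2 where n2:
      "\<And>n. n \<ge> n2 \<Longrightarrow> \<bar>(\<integral>x. w n x \<partial>M) - m\<bar> < 1" by auto
    have dM: "\<bar>(\<integral>x. w n x * g (Y n x) \<partial>M) - (\<integral>x. w n x * p (Y n x) \<partial>M)\<bar> \<le> e * (\<integral>x. w n x \<partial>M)" for n
    proof -
      have "\<bar>(\<integral>x. w n x * g (Y n x) \<partial>M) - (\<integral>x. w n x * p (Y n x) \<partial>M)\<bar>
          = \<bar>\<integral>x. w n x * g (Y n x) - w n x * p (Y n x) \<partial>M\<bar>"
        using intM[OF g] intM[OF pc] by simp
      also have "\<dots> \<le> (\<integral>x. \<bar>w n x * g (Y n x) - w n x * p (Y n x)\<bar> \<partial>M)"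
        by (rule integral_abs_bound)
      also have "\<dots> \<le> (\<integral>x. e * w n x \<partial>M)"
      proof (rule integral_mono)
        fix x
        show "\<bar>w n x * g (Y n x) - w n x * p (Y n x)\<bar> \<le> e * w n x"
          using w(2,3)[of n x] gp[of "Y n x"]
          by (cases "w n x = 0") (auto simp: right_diff_distrib[symmetric] abs_mult intro!: less_imp_le)
      qed (use intM[OF g] intM[OF pc] w in auto)
      finally show ?thesis by simp
    qed
    have dK: "\<bar>(\<integral>x. v x * g (V x) \<partial>K) - (\<integral>x. v x * p (V x) \<partial>K)\<bar> \<le> e * m"
    proof -
      have "\<bar>(\<integral>x. v x * g (V x) \<partial>K) - (\<integral>x. v x * p (V x) \<partial>K)\<bar>
          = \<bar>\<integral>x. v x * g (V x) - v x * p (V x) \<partial>K\<bar>"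
        using intK[OF g] intK[OF pc] by simp
      also have "\<dots> \<le> (\<integral>x. \<bar>v x * g (V x) - v x * p (V x)\<bar> \<partial>K)"
        by (rule integral_abs_bound)
      also have "\<dots> \<le> (\<integral>x. e * v x \<partial>K)"
      proof (rule integral_mono)
        fix x
        show "\<bar>v x * g (V x) - v x * p (V x)\<bar> \<le> e * v x"
          using v(2,3)[of x] gp[of "V x"]
          by (cases "v x = 0") (auto simp: right_diff_distrib[symmetric] abs_mult intro!: less_imp_le)
      qed (use intK[OF g] intK[OF pc] v in auto)
      finally show ?thesis by (simp add: m_def)
    qed
    have "\<bar>(\<integral>x. w n x * g (Y n x) \<partial>M) - (\<integral>x. v x * g (V x) \<partial>K)\<bar> < r" if "n \<ge> max n1 n2" for n
    proof -
      have "e * (\<integral>x. w n x \<partial>M) \<le> e * (m + 1)"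
        using n2[of n] that e by (intro mult_left_mono) auto
      then show ?thesis
        using dM[of n] dK n1[of n] that e(2) unfolding distrib_left by auto
    qed
    then show "\<exists>no. \<forall>n\<ge>no. norm ((\<integral>x. w n x * g (Y n x) \<partial>M) - (\<integral>x. v x * g (V x) \<partial>K)) < r"
      unfolding real_norm_def by blast
  qed
qed

section \<open>Tails from Laplace transforms along a sequence\<close>

text \<open>For \<open>v = exp (- x) \<ge> 1\<close>, Bernoulli's inequality bounds
  \<open>v ^ Suc k - 1\<close> by one \<open>m\<close>-th of \<open>v ^ (m * Suc k) - 1\<close>. The
  right-hand side is a square of a kind whose expectation is a combination of values of the
  transform, so mass on the negative axis is controlled by the transform itself.\<close>

lemma Bernoulli_exp_bound:
  fixes x :: real and k m :: nat
  assumes "x \<le> 0" "m > 0"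
  shows "(1 - exp (- x))\<^sup>2 * exp (- real k * x) \<le> (1 - exp (- real (m * Suc k) * x))\<^sup>2 / (real m)\<^sup>2"
proof -
  define v where "v = exp (- x)"
  have v: "v \<ge> 1" using assms by (simp add: v_def)
  have pow: "exp (- real i * x) = v ^ i" for i
    by (simp add: v_def flip: exp_of_nat_mult)
  \<comment> \<open>A second factor \<open>v ^ k \<ge> 1\<close> completes the square.\<close>
  have "(v - 1)\<^sup>2 * v ^ k \<le> (v - 1)\<^sup>2 * (v ^ k * v ^ k)"
    using one_le_power[OF v, of k] by (intro mult_left_mono) auto
  also have "\<dots> = (v ^ Suc k - v ^ k)\<^sup>2" by (simp add: power2_eq_square algebra_simps)
  also have "\<dots> \<le> (v ^ Suc k - 1)\<^sup>2"
    using v one_le_power[OF v, of k] by (intro power_mono) (auto simp: mult_le_cancel_right1)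
  also have "\<dots> = (real m * (v ^ Suc k - 1))\<^sup>2 / (real m)\<^sup>2"
    using assms by (simp add: power_mult_distrib)
  also have "\<dots> \<le> ((v ^ Suc k) ^ m - 1)\<^sup>2 / (real m)\<^sup>2"
  proof (intro divide_right_mono power_mono)
    have "1 + real m * (v ^ Suc k - 1) \<le> (1 + (v ^ Suc k - 1)) ^ m"
      using one_le_power[OF v, of "Suc k"] by (intro Bernoulli_inequality) linarith
    then show "real m * (v ^ Suc k - 1) \<le> (v ^ Suc k) ^ m - 1" by simp
  qed (use one_le_power[OF v, of "Suc k"] in auto)
  also have "(v ^ Suc k) ^ m = v ^ (m * Suc k)"
    by (simp only: power_mult [symmetric] mult.commute)
  finally show ?thesis by (simp only: pow flip: v_def) (simp add: power2_commute)
qed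

text \<open>The limit measure with density \<open>\<beta> * z powr (- \<beta> - 1)\<close> has
  infinite mass near 0. The weight \<open>(1 - exp (- z))\<^sup>2\<close> makes it finite, and can
  be divided out again from test functions that vanish near \<open>z = 0\<close>.\<close>

lemma tail_asymptotics_of_laplace:
  fixes X :: "nat \<Rightarrow> 'a \<Rightarrow> real" and a :: "nat \<Rightarrow> real" and \<beta> :: real
  assumes "prob_space M" and \<beta>: "0 < \<beta>" "\<beta> < 2" "\<beta> \<noteq> 1"
    and [measurable]: "\<And>n. X n \<in> borel_measurable M"
    and int: "\<And>n k. integrable M (\<lambda>\<omega>. exp (- real k * X n \<omega>))"
    and a: "\<And>n. a n > 0"
    and lim: "\<And>k. k > 0 \<Longrightarrow> (\<lambda>n. ((\<integral>\<omega>. exp (- real k * X n \<omega>) \<partial>M) - 1) / a n)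
                 \<longlonglongrightarrow> - Gamma (1 - \<beta>) * real k powr \<beta>"
  shows "(\<lambda>n. measure M {\<omega> \<in> space M. X n \<omega> > 1} / a n) \<longlonglongrightarrow> 1"
proof -
  interpret prob_space M by fact
  \<comment> \<open>\<open>f k\<close> has two roles: it is the weight \<open>f 0\<close> times the
    \<open>k\<close>-th power of \<open>exp (- x)\<close>, and it is a second difference in
    \<open>k\<close> of \<open>exp (- k x)\<close>, hence accessible from the transform.\<close>
  define f where "f k x = (1 - exp (- x))\<^sup>2 * exp (- real k * x)" for k :: nat and x :: real
  have [measurable]: "f k \<in> borel_measurable borel" for k unfolding f_def by measurable
  have f_nonneg: "f k x \<ge> 0" for k x by (simp add: f_def)
  have f_exp: "f k x = exp (- real k * x) - 2 * exp (- real (k + 1) * x) + exp (- real (k + 2) * x)" for k x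
    by (simp add: f_def power2_eq_square algebra_simps flip: exp_add)
  have f_int: "integrable M (\<lambda>\<omega>. f k (X n \<omega>))" for k n
    unfolding f_exp by (intro Bochner_Integration.integrable_add Bochner_Integration.integrable_diff integrable_mult_right int)
  \<comment> \<open>Second differences starting at \<open>k = 0\<close> also need the value there:
    the expectation is 1 and \<open>0 powr \<beta> = 0\<close>.\<close>
  have lim': "(\<lambda>n. ((\<integral>\<omega>. exp (- real k * X n \<omega>) \<partial>M) - 1) / a n)
      \<longlonglongrightarrow> - Gamma (1 - \<beta>) * real k powr \<beta>" for k
    using lim[of k] by (cases "k = 0") (auto simp: prob_space)
  define \<Delta> where "\<Delta> k = - Gamma (1 - \<beta>) *
    ((real k + 2) powr \<beta> - 2 * (real k + 1) powr \<beta> + real k powr \<beta>)" for k :: nat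
  \<comment> \<open>The coefficients 1, -2, 1 sum to zero, so the subtracted constants 1
    cancel.\<close>
  have f_lim: "(\<lambda>n. (\<integral>\<omega>. f k (X n \<omega>) \<partial>M) / a n) \<longlonglongrightarrow> \<Delta> k" for k
  proof -
    have "(\<integral>\<omega>. f k (X n \<omega>) \<partial>M) / a n =
      ((\<integral>\<omega>. exp (- real k * X n \<omega>) \<partial>M) - 1) / a n
      - 2 * (((\<integral>\<omega>. exp (- real (k + 1) * X n \<omega>) \<partial>M) - 1) / a n)
      + ((\<integral>\<omega>. exp (- real (k + 2) * X n \<omega>) \<partial>M) - 1) / a n" for n
      unfolding f_exp using int[of k n] int[of "k+1" n] int[of "k+2" n] a[of n]
      by (simp add: field_simps del: of_nat_add)
    moreover have "\<Delta> k = - Gamma (1 - \<beta>) * real k powr \<beta>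
      - 2 * (- Gamma (1 - \<beta>) * real (k + 1) powr \<beta>) + - Gamma (1 - \<beta>) * real (k + 2) powr \<beta>"
      by (simp add: \<Delta>_def algebra_simps)
    ultimately show ?thesis
      by (simp only:) (intro tendsto_intros lim')
  qed

  \<comment> \<open>This is the second difference at 0 with step \<open>m\<close>; what matters is
    the growth of the limit like \<open>m powr \<beta>\<close>.\<close>
  have square_lim: "(\<lambda>n. (\<integral>\<omega>. (1 - exp (- real m * X n \<omega>))\<^sup>2 \<partial>M) / a n)
      \<longlonglongrightarrow> - Gamma (1 - \<beta>) * (2 powr \<beta> - 2) * real m powr \<beta>" for m
  proof -
    have eq: "(1 - exp (- real m * x))\<^sup>2 = exp (- real (2 * m) * x) - 2 * exp (- real m * x) + 1" for x
      by (simp add: power2_eq_square algebra_simps flip: exp_add)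
    have "(\<integral>\<omega>. (1 - exp (- real m * X n \<omega>))\<^sup>2 \<partial>M) / a n =
      ((\<integral>\<omega>. exp (- real (2 * m) * X n \<omega>) \<partial>M) - 1) / a n
      - 2 * (((\<integral>\<omega>. exp (- real m * X n \<omega>) \<partial>M) - 1) / a n)" for n
      unfolding eq using int[of m n] int[of "2 * m" n] a[of n] prob_space
      by (simp add: field_simps del: of_nat_mult)
    moreover have "- Gamma (1 - \<beta>) * (2 powr \<beta> - 2) * real m powr \<beta> =
      - Gamma (1 - \<beta>) * real (2 * m) powr \<beta> - 2 * (- Gamma (1 - \<beta>) * real m powr \<beta>)"
      by (simp add: powr_mult algebra_simps)
    ultimately show ?thesis
      by (simp only:) (intro tendsto_intros lim')
  qed
  have square_int: "integrable M (\<lambda>\<omega>. (1 - exp (- real m * X n \<omega>))\<^sup>2)" for m n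
  proof -
    have eq: "(1 - exp (- real m * x))\<^sup>2 = exp (- real (2 * m) * x) - 2 * exp (- real m * x) + 1" for x
      by (simp add: power2_eq_square algebra_simps flip: exp_add)
    show ?thesis unfolding eq using int[of m n] int[of "2 * m" n] by (simp del: of_nat_mult)
  qed

  have neg_int: "integrable M (\<lambda>\<omega>. indicator {..0} (X n \<omega>) * f k (X n \<omega>))" for n k
    by (rule Bochner_Integration.integrable_bound[OF f_int[of k n]]) (auto simp: indicator_def)
  have neg_lim: "(\<lambda>n. (\<integral>\<omega>. indicator {..0} (X n \<omega>) * f k (X n \<omega>) \<partial>M) / a n) \<longlonglongrightarrow> 0" for k
  proof (rule order_tendstoI)
    fix y :: real assume "y < 0"
    moreover have "0 \<le> (\<integral>\<omega>. indicator {..0} (X n \<omega>) * f k (X n \<omega>) \<partial>M) / a n" for n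
      using a[of n] f_nonneg by (intro divide_nonneg_pos Bochner_Integration.integral_nonneg) auto
    ultimately show "\<forall>\<^sub>F n in sequentially. y < (\<integral>\<omega>. indicator {..0} (X n \<omega>) * f k (X n \<omega>) \<partial>M) / a n"
      by (intro always_eventually allI) (rule less_le_trans)
  next
    fix y :: real assume "0 < y"
    \<comment> \<open>\<open>c m\<close> is the limit in \<open>n\<close> of the Bernoulli bound
      with parameter \<open>m\<close>. It is a constant multiple of
      \<open>m powr (\<beta> - 2)\<close>, so some \<open>m\<close> with \<open>c m < y\<close> can
      be fixed before \<open>n\<close> grows.\<close>
    define c where "c m = - Gamma (1 - \<beta>) * (2 powr \<beta> - 2) * real (m * Suc k) powr \<beta> / (real m)\<^sup>2" for m
    have "c m = - Gamma (1 - \<beta>) * (2 powr \<beta> - 2) * real (Suc k) powr \<beta> * real m powr (\<beta> - 2)" if "m > 0" for m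
      using that by (simp add: c_def powr_mult powr_diff del: of_nat_Suc mult_Suc_right)
    then have "\<forall>\<^sub>F m in sequentially. - Gamma (1 - \<beta>) * (2 powr \<beta> - 2) * real (Suc k) powr \<beta> * real m powr (\<beta> - 2) = c m"
      by (auto simp: eventually_sequentially intro!: exI[of _ 1])
    moreover have "(\<lambda>m. real m powr (\<beta> - 2)) \<longlonglongrightarrow> 0"
      using \<beta> by (intro tendsto_neg_powr filterlim_real_sequentially) auto
    then have "(\<lambda>m. - Gamma (1 - \<beta>) * (2 powr \<beta> - 2) * real (Suc k) powr \<beta> * real m powr (\<beta> - 2)) \<longlonglongrightarrow> 0"
      by (rule tendsto_mult_right_zero)
    ultimately have "c \<longlonglongrightarrow> 0"
      by (rule Lim_transform_eventually[rotated])
    then have "\<forall>\<^sub>F m in sequentially. c m < y \<and> m > 0"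
      using \<open>0 < y\<close> by (intro eventually_conj order_tendstoD(2) eventually_gt_at_top)
    then obtain m where m: "c m < y" "m > 0" by (auto simp: eventually_sequentially)
    have "(\<lambda>n. (\<integral>\<omega>. (1 - exp (- real (m * Suc k) * X n \<omega>))\<^sup>2 \<partial>M) / a n / (real m)\<^sup>2) \<longlonglongrightarrow> c m"
      unfolding c_def by (intro tendsto_divide square_lim tendsto_const) (use m in auto)
    from order_tendstoD(2)[OF this m(1)]
    show "\<forall>\<^sub>F n in sequentially. (\<integral>\<omega>. indicator {..0} (X n \<omega>) * f k (X n \<omega>) \<partial>M) / a n < y"
    proof eventually_elim
      case (elim n)
      have "(\<integral>\<omega>. indicator {..0} (X n \<omega>) * f k (X n \<omega>) \<partial>M)
          \<le> (\<integral>\<omega>. (1 - exp (- real (m * Suc k) * X n \<omega>))\<^sup>2 / (real m)\<^sup>2 \<partial>M)"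
      proof (rule integral_mono[OF neg_int])
        show "integrable M (\<lambda>\<omega>. (1 - exp (- real (m * Suc k) * X n \<omega>))\<^sup>2 / (real m)\<^sup>2)"
          using square_int by (rule integrable_divide_zero)
        show "indicator {..0} (X n \<omega>) * f k (X n \<omega>)
            \<le> (1 - exp (- real (m * Suc k) * X n \<omega>))\<^sup>2 / (real m)\<^sup>2" for \<omega>
          using Bernoulli_exp_bound[of "X n \<omega>" m k] m by (simp add: f_def indicator_def del: of_nat_mult)
      qed
      then have "(\<integral>\<omega>. indicator {..0} (X n \<omega>) * f k (X n \<omega>) \<partial>M)
          \<le> (\<integral>\<omega>. (1 - exp (- real (m * Suc k) * X n \<omega>))\<^sup>2 \<partial>M) / (real m)\<^sup>2"
        by simp
      from divide_right_mono[OF this, of "a n"] elim show ?case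
        using a[of n] by (simp add: mult.commute del: of_nat_mult)
    qed
  qed

  \<comment> \<open>Both weights live on the positive half-line, where \<open>exp (- x)\<close> lies
    in the unit interval; \<open>w\<close> absorbs the normalisation \<open>1 / a n\<close>.\<close>
  define w where "w n \<omega> = indicator {0<..} (X n \<omega>) * f 0 (X n \<omega>) / a n" for n \<omega>
  define v where "v z = indicator {0<..} z * (f 0 z * (\<beta> * z powr (- \<beta> - 1)))" for z :: real
  have pos_int: "integrable M (\<lambda>\<omega>. indicator {0<..} (X n \<omega>) * f k (X n \<omega>))" for n k
    by (rule Bochner_Integration.integrable_bound[OF f_int[of k n]]) (auto simp: indicator_def)
  have v: "has_bochner_integral lborel (\<lambda>z. v z * exp (- z) ^ k) (\<Delta> k)" for k
    using second_difference_integral[OF \<beta>, of "real k"]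
    by (simp add: v_def f_def \<Delta>_def mult_ac flip: exp_of_nat_mult)
  have moments: "(\<lambda>n. \<integral>\<omega>. w n \<omega> * exp (- X n \<omega>) ^ k \<partial>M) \<longlonglongrightarrow> (\<integral>z. v z * exp (- z) ^ k \<partial>lborel)" for k
  proof -
    have wf: "w n \<omega> * exp (- X n \<omega>) ^ k = indicator {0<..} (X n \<omega>) * f k (X n \<omega>) / a n" for n \<omega>
      by (simp add: w_def f_def flip: exp_of_nat_mult)
    have "(\<integral>\<omega>. w n \<omega> * exp (- X n \<omega>) ^ k \<partial>M) =
        (\<integral>\<omega>. f k (X n \<omega>) \<partial>M) / a n - (\<integral>\<omega>. indicator {..0} (X n \<omega>) * f k (X n \<omega>) \<partial>M) / a n" for n
    proof -
      have "(\<integral>\<omega>. indicator {0<..} (X n \<omega>) * f k (X n \<omega>) \<partial>M) =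
          (\<integral>\<omega>. f k (X n \<omega>) - indicator {..0} (X n \<omega>) * f k (X n \<omega>) \<partial>M)"
        by (intro Bochner_Integration.integral_cong) (auto simp: indicator_def)
      then show ?thesis using f_int[of k n] neg_int[of n k] unfolding wf
        by (simp add: diff_divide_distrib)
    qed
    moreover have "(\<lambda>n. (\<integral>\<omega>. f k (X n \<omega>) \<partial>M) / a n
        - (\<integral>\<omega>. indicator {..0} (X n \<omega>) * f k (X n \<omega>) \<partial>M) / a n) \<longlonglongrightarrow> \<Delta> k - 0"
      by (intro tendsto_diff f_lim neg_lim)
    ultimately show ?thesis using v[of k] by (simp add: has_bochner_integral_integral_eq)
  qed

  \<comment> \<open>A continuous ramp in the variable \<open>exp (- x)\<close> lies between the
    indicators of \<open>x \<ge> b\<close> and \<open>x > u\<close>, and the limit measure gives the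
    half-line beyond \<open>y\<close> the mass \<open>y powr (- \<beta>)\<close>. The lower bound
    takes \<open>u = 1\<close> and \<open>b\<close> close to 1, the upper bound \<open>b = 1\<close>
    and \<open>u\<close> close to 1.\<close>
  have sandwich: "\<exists>I G. I \<longlonglongrightarrow> G \<and> b powr (- \<beta>) \<le> G \<and> G \<le> u powr (- \<beta>) \<and>
      (\<forall>n. measure M {\<omega> \<in> space M. X n \<omega> \<ge> b} / a n \<le> I n \<and>
           I n \<le> measure M {\<omega> \<in> space M. X n \<omega> > u} / a n)"
    if ub: "0 < u" "u < b" for u b :: real
  proof -
    define ramp where "ramp x = min 1 (max 0 ((exp (- u) - x) / (exp (- u) - exp (- b))))" for x :: real
    define g where "g x = ramp x / (1 - min x (exp (- u)))\<^sup>2" for x :: real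
    \<comment> \<open>\<open>ramp\<close> vanishes for \<open>x \<ge> exp (- u)\<close>, so the \<open>min\<close> only keeps the denominator of \<open>g\<close> away from \<open>0\<close>.\<close>
    have d: "exp (- u) - exp (- b) > 0" using ub by simp
    have "exp (- u) < 1" using ub by simp
    then have m1: "1 - min x (exp (- u)) > 0" for x :: real by linarith
    have gc: "continuous_on UNIV g"
      unfolding g_def ramp_def by (intro continuous_intros) (use m1 d in \<open>auto simp: less_imp_neq[symmetric]\<close>)
    have ramp_ge: "ramp (exp (- x)) = 1" if "x \<ge> b" for x
      using that d by (simp add: ramp_def)
    have ramp_le: "ramp (exp (- x)) = 0" if "x \<le> u" for x
      using that d by (simp add: ramp_def field_simps max_def min_def)
    have ramp_range: "0 \<le> ramp x" "ramp x \<le> 1" for x by (auto simp: ramp_def)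
    \<comment> \<open>Beyond \<open>u\<close> the \<open>min\<close> is inactive and the weight
      cancels; up to \<open>u\<close> both sides are 0.\<close>
    have fg: "f 0 x * g (exp (- x)) = ramp (exp (- x))" if "x > 0" for x
    proof (cases "x \<le> u")
      case False
      then have "min (exp (- x)) (exp (- u)) = exp (- x)" by simp
      then show ?thesis using that by (simp add: g_def f_def)
    qed (simp add: g_def ramp_le)
    define I where "I n = (\<integral>\<omega>. w n \<omega> * g (exp (- X n \<omega>)) \<partial>M)" for n
    define G where "G = (\<integral>z. v z * g (exp (- z)) \<partial>lborel)"
    have "I \<longlonglongrightarrow> G" unfolding I_def G_def
    proof (rule weighted_moments_imp_continuous[OF _ _ _ _ _ _ _ _ moments gc])
      show "integrable M (w n)" for n
        unfolding w_def by (intro integrable_divide_zero pos_int)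
      show "integrable lborel v" using v[of 0] by (simp add: has_bochner_integral_iff)
      show "0 \<le> w n \<omega>" for n \<omega> using a[of n] by (simp add: w_def f_nonneg)
      show "0 \<le> v z" for z using \<beta> by (simp add: v_def f_nonneg)
    qed (auto simp: w_def v_def indicator_def split: if_splits)
    moreover have "b powr (- \<beta>) \<le> G" "G \<le> u powr (- \<beta>)"
    proof -
      have tail: "has_bochner_integral lborel
          (\<lambda>z. indicator {y..} z * (\<beta> * z powr (- \<beta> - 1))) (y powr (- \<beta>))" if "y > 0" for y :: real
      proof (rule has_bochner_integral_of_has_integral_nonneg)
        have "((\<lambda>z. \<beta> * z powr (- \<beta> - 1)) has_integral \<beta> * (- (y powr (- \<beta> - 1 + 1)) / (- \<beta> - 1 + 1))) {y..}"
          by (intro has_integral_mult_right has_integral_powr_to_inf) (use that \<beta> in auto)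
        then show "((\<lambda>z. \<beta> * z powr (- \<beta> - 1)) has_integral y powr (- \<beta>)) {y..}"
          using \<beta> by simp
      qed (use \<beta> in auto)
      have vg: "v z * g (exp (- z)) = indicator {0<..} z * (ramp (exp (- z)) * (\<beta> * z powr (- \<beta> - 1)))" for z
        using fg[of z] by (cases "z > 0") (auto simp: v_def)
      have lower: "indicator {b..} z * (\<beta> * z powr (- \<beta> - 1)) \<le> v z * g (exp (- z))" for z
        unfolding vg using \<beta> ub ramp_ge[of z] ramp_range[of "exp (- z)"] by (auto simp: indicator_def)
      have upper: "v z * g (exp (- z)) \<le> indicator {u..} z * (\<beta> * z powr (- \<beta> - 1))" for z
        unfolding vg using \<beta> ub ramp_le[of z] ramp_range[of "exp (- z)"]
        by (auto simp: indicator_def intro!: mult_left_le_one_le)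
      have [measurable]: "g \<in> borel_measurable borel" by (rule borel_measurable_continuous_onI[OF gc])
      have vgi: "integrable lborel (\<lambda>z. v z * g (exp (- z)))"
      proof (rule Bochner_Integration.integrable_bound)
        show "integrable lborel (\<lambda>z. indicator {u..} z * (\<beta> * z powr (- \<beta> - 1)))"
          using tail[OF ub(1)] by (simp add: has_bochner_integral_iff)
        have "0 \<le> indicator {b..} z * (\<beta> * z powr (- \<beta> - 1))" for z using \<beta> by auto
        from order_trans[OF this lower] upper
        show "AE z in lborel. norm (v z * g (exp (- z))) \<le> norm (indicator {u..} z * (\<beta> * z powr (- \<beta> - 1)))"
          by (intro AE_I2) (smt (verit) real_norm_def)
      qed (simp add: v_def)
      have "(LBINT z. indicator {b..} z * (\<beta> * z powr (- \<beta> - 1))) \<le> G"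
        unfolding G_def by (rule integral_mono[OF _ vgi lower])
          (use tail[of b] ub in \<open>auto simp: has_bochner_integral_iff\<close>)
      moreover have "G \<le> (LBINT z. indicator {u..} z * (\<beta> * z powr (- \<beta> - 1)))"
        unfolding G_def by (rule integral_mono[OF vgi _ upper])
          (use tail[of u] ub in \<open>auto simp: has_bochner_integral_iff\<close>)
      ultimately show "b powr (- \<beta>) \<le> G" "G \<le> u powr (- \<beta>)"
        using has_bochner_integral_integral_eq[OF tail] ub by auto
    qed
    moreover have "measure M {\<omega> \<in> space M. X n \<omega> \<ge> b} / a n \<le> I n \<and>
           I n \<le> measure M {\<omega> \<in> space M. X n \<omega> > u} / a n" for n
    proof -
      have [measurable]: "ramp \<in> borel_measurable borel" unfolding ramp_def by measurable
      \<comment> \<open>This also holds where \<open>X n \<omega> \<le> 0\<close>: the weight is 0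
        there, and so is the ramp, because \<open>u > 0\<close>.\<close>
      have wg: "w n \<omega> * g (exp (- X n \<omega>)) = ramp (exp (- X n \<omega>)) / a n" for \<omega>
        using fg[of "X n \<omega>"] ramp_le[of "X n \<omega>"] ub by (cases "X n \<omega> > 0") (auto simp: w_def)
      have ri: "integrable M (\<lambda>\<omega>. ramp (exp (- X n \<omega>)))"
        by (rule integrable_const_bound[of _ 1]) (use ramp_range in auto)
      have ind: "integrable M (indicator {\<omega> \<in> space M. X n \<omega> \<ge> b} :: 'a \<Rightarrow> real)"
        "integrable M (indicator {\<omega> \<in> space M. X n \<omega> > u} :: 'a \<Rightarrow> real)"
        by (auto intro!: integrable_real_indicator simp: emeasure_eq_measure)
      have "(\<integral>\<omega>. indicator {\<omega> \<in> space M. X n \<omega> \<ge> b} \<omega> \<partial>M) \<le> (\<integral>\<omega>. ramp (exp (- X n \<omega>)) \<partial>M)"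
        using ramp_ge ramp_range by (intro integral_mono[OF ind(1) ri]) (auto simp: indicator_def)
      moreover have "(\<integral>\<omega>. ramp (exp (- X n \<omega>)) \<partial>M) \<le> (\<integral>\<omega>. indicator {\<omega> \<in> space M. X n \<omega> > u} \<omega> \<partial>M)"
        using ramp_le ramp_range by (intro integral_mono[OF ri ind(2)]) (auto simp: indicator_def not_less)
      ultimately show ?thesis
        using a[of n] by (simp add: I_def wg divide_right_mono Int_def conj_commute)
    qed
    ultimately show ?thesis by blast
  qed

  have cont: "((\<lambda>y. y powr (- \<beta>)) \<longlongrightarrow> 1 powr (- \<beta>)) (at 1 within S)" for S :: "real set"
    by (intro tendsto_intros) auto
  show ?thesis
  proof (rule order_tendstoI)
    fix y :: real assume "y < 1"
    with order_tendstoD(1)[OF cont] have "\<forall>\<^sub>F b in at_right (1::real). y < b powr (- \<beta>)"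
      by simp
    then have "\<forall>\<^sub>F b in at_right (1::real). y < b powr (- \<beta>) \<and> 1 < b"
      by (intro eventually_conj eventually_at_right_less)
    from eventually_happens[OF this] obtain b :: real where b: "y < b powr (- \<beta>)" "1 < b"
      using trivial_limit_at_right_real by blast
    from sandwich[of 1 b] b obtain I G where IG: "I \<longlonglongrightarrow> G" "b powr (- \<beta>) \<le> G"
      and I: "\<And>n. I n \<le> measure M {\<omega> \<in> space M. X n \<omega> > 1} / a n"
      by auto
    have "\<forall>\<^sub>F n in sequentially. y < I n"
      using order_tendstoD(1)[OF IG(1)] IG(2) b by auto
    then show "\<forall>\<^sub>F n in sequentially. y < measure M {\<omega> \<in> space M. X n \<omega> > 1} / a n"
      by eventually_elim (rule less_le_trans[OF _ I])
  next
    fix y :: real assume "1 < y"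
    with order_tendstoD(2)[OF cont] have "\<forall>\<^sub>F u in at_left (1::real). u powr (- \<beta>) < y"
      by simp
    then have "\<forall>\<^sub>F u in at_left (1::real). u powr (- \<beta>) < y \<and> u \<in> {0<..<1}"
      by (intro eventually_conj eventually_at_left_real) auto
    from eventually_happens[OF this] obtain u :: real where u: "u powr (- \<beta>) < y" "0 < u" "u < 1"
      using trivial_limit_at_left_real by auto
    from sandwich[of u 1] u obtain I G where IG: "I \<longlonglongrightarrow> G" "G \<le> u powr (- \<beta>)"
      and I: "\<And>n. measure M {\<omega> \<in> space M. X n \<omega> \<ge> 1} / a n \<le> I n"
      by auto
    have "\<forall>\<^sub>F n in sequentially. I n < y"
      using order_tendstoD(2)[OF IG(1)] IG(2) u by auto
    then show "\<forall>\<^sub>F n in sequentially. measure M {\<omega> \<in> space M. X n \<omega> > 1} / a n < y"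
    proof eventually_elim
      case (elim n)
      have "measure M {\<omega> \<in> space M. X n \<omega> > 1} \<le> measure M {\<omega> \<in> space M. X n \<omega> \<ge> 1}"
        by (intro finite_measure_mono) auto
      from divide_right_mono[OF this, of "a n"] a[of n] I[of n] elim show ?case by simp
    qed
  qed
qed

section \<open>Uniformity by passing to sequences\<close>

lemma (in real_distribution) interval_measure_cdf: "interval_measure (cdf M) = M"
  by (intro cdf_unique real_distribution_interval_measure cdf_interval_measure
        real_distribution_axioms cdf_nondecreasing cdf_is_right_cont
        cdf_lim_at_bot cdf_lim_at_top_prob)

text \<open>Nonemptiness of \<open>A t\<close> excludes the value \<open>-\<infinity>\<close> of an
  empty supremum; nonnegativity then supplies the lower bound.\<close>

lemma SUP_ereal_tendsto_zeroI:
  fixes R :: "'a \<Rightarrow> 'b \<Rightarrow> real"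
  assumes "\<And>t. A t \<noteq> {}" and nonneg: "\<And>t x. 0 \<le> R t x"
    and le: "\<And>\<epsilon>. \<epsilon> > 0 \<Longrightarrow> \<forall>\<^sub>F t in G. \<forall>x\<in>A t. R t x \<le> \<epsilon>"
  shows "((\<lambda>t. SUP x\<in>A t. ereal (R t x)) \<longlongrightarrow> 0) G"
proof (rule order_tendstoI)
  fix y :: ereal assume "y < 0"
  have "0 \<le> (SUP x\<in>A t. ereal (R t x))" for t
    using assms(1)[of t] nonneg by (auto intro: SUP_upper2)
  with \<open>y < 0\<close> show "\<forall>\<^sub>F t in G. y < (SUP x\<in>A t. ereal (R t x))"
    by (intro always_eventually allI) (rule less_le_trans)
next
  fix y :: ereal assume "0 < y"
  then obtain \<epsilon> where \<epsilon>: "0 < ereal \<epsilon>" "ereal \<epsilon> < y" using ereal_dense2 by blast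
  then have "\<forall>\<^sub>F t in G. \<forall>x\<in>A t. R t x \<le> \<epsilon>" by (intro le) simp
  then show "\<forall>\<^sub>F t in G. (SUP x\<in>A t. ereal (R t x)) < y"
  proof eventually_elim
    case (elim t)
    then have "(SUP x\<in>A t. ereal (R t x)) \<le> ereal \<epsilon>" by (intro SUP_least) simp
    then show ?case using \<epsilon>(2) by (rule le_less_trans)
  qed
qed

theorem theorem2:
  fixes \<beta> :: real
    and M :: "'a measure"
    and Z :: "real \<Rightarrow> 'a \<Rightarrow> real"
    and F L E :: "real \<Rightarrow> real \<Rightarrow> real"
    and s :: "real \<Rightarrow> real"
  assumes "\<beta> \<in> {0<..<2} - {1}"
    and "prob_space M"
    and "\<And>t. t \<ge> 0 \<Longrightarrow> Z t \<in> borel_measurable M"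
    and "\<And>t. t \<ge> 0 \<Longrightarrow> F t = cdf (distr M borel (Z t))"
    and "\<And>t u. t \<ge> 0 \<Longrightarrow> u \<ge> 0 \<Longrightarrow> integrable (interval_measure (F t)) (\<lambda>x. exp (- u * x))"
    and "L \<in> L_sep_pos"
    and "\<And>t u. t \<ge> 0 \<Longrightarrow> u \<ge> 0 \<Longrightarrow>
           laplace_stieltjes (F t) u =
             (if u = 0 then 1 else 1 - Gamma (1 - \<beta>) * L t (1 / u) * u powr \<beta> + E t u)"
    and "\<And>t. t \<ge> 0 \<Longrightarrow> E t \<in> o[at_right 0](\<lambda>u. L t (1 / u) * u powr \<beta>)"
    and "\<beta> < 1 \<Longrightarrow> (\<And>t. t \<ge> 0 \<Longrightarrow> AE \<omega> in M. Z t \<omega> \<ge> 0)"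
    and "\<And>t. t \<ge> 0 \<Longrightarrow> s t > 0"
    and "(s \<longlongrightarrow> 0) at_top"
    and "\<And>lam. lam > 0 \<Longrightarrow>
           ((\<lambda>t. SUP u\<in>{0<..lam * s t}. ereal (\<bar>E t u\<bar> / (L t (1 / u) * u powr \<beta>))) \<longlongrightarrow> 0) at_top"
  shows "((\<lambda>t. SUP x\<in>{1 / s t..}.
             ereal \<bar>measure M {\<omega> \<in> space M. Z t \<omega> > x} / (L t x * x powr (- \<beta>)) - 1\<bar>) \<longlongrightarrow> 0) at_top"
proof -
  interpret prob_space M by fact
  note Z_meas = assms(3) and F = assms(4) and expansion = assms(7) and s_pos = assms(10)
    and s_lim = assms(11) and E_lim = assms(12)
  from assms(1) have \<beta>: "0 < \<beta>" "\<beta> < 2" "\<beta> \<noteq> 1" by auto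
  from assms(6) obtain c l where L: "\<And>t x. t \<ge> 0 \<Longrightarrow> x > 0 \<Longrightarrow> L t x = c t * l x"
    and c_pos: "\<forall>\<^sub>F t in at_top. c t > 0" and l_pos: "\<forall>\<^sub>F x in at_top. l x > 0"
    and l_sv: "slowly_varying l"
    unfolding L_sep_pos_def by auto
  from l_pos obtain x0 where x0: "\<And>x. x \<ge> x0 \<Longrightarrow> l x > 0" by (auto simp: eventually_at_top_linorder)
  \<comment> \<open>Beyond \<open>x1\<close> the function \<open>l\<close> is positive; the 1 makes
    \<open>1 / x1\<close> a legitimate threshold for \<open>s\<close>.\<close>
  define x1 where "x1 = max 1 x0"
  have x1_pos: "x1 > 0" by (simp add: x1_def)
  define R where "R t x = \<bar>prob {\<omega> \<in> space M. Z t \<omega> > x} / (L t x * x powr (- \<beta>)) - 1\<bar>" for t x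
  \<comment> \<open>If the bound failed for arbitrarily large \<open>t\<close>, there would be
    \<open>t n\<close> tending to infinity and \<open>x n \<ge> 1 / s (t n)\<close> with
    \<open>R (t n) (x n) > \<epsilon>\<close> for all \<open>n\<close>. The contradiction is that
    \<open>R\<close> tends to 0 along every such choice.\<close>
  have key: "\<forall>\<^sub>F t in at_top. \<forall>x\<in>{1 / s t..}. R t x \<le> \<epsilon>" if "\<epsilon> > 0" for \<epsilon>
  proof (rule ccontr)
    assume "\<not> ?thesis"
    then have ex: "\<exists>\<^sub>F t in at_top. \<exists>x\<ge>1 / s t. R t x > \<epsilon>"
      by (simp add: frequently_def not_less Ball_def)
    \<comment> \<open>\<open>s t < 1 / x1\<close> pushes every admissible \<open>x\<close> beyond
      \<open>x1\<close>, \<open>t \<ge> real n\<close> forces divergence, and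
      \<open>t \<ge> 0\<close> is the range on which the hypotheses speak.\<close>
    have ev: "\<forall>\<^sub>F t in at_top. c t > 0 \<and> s t < 1 / x1 \<and> t \<ge> max 0 (real n)" for n
      using order_tendstoD(2)[OF s_lim, of "1 / x1"] c_pos
      by (intro eventually_conj eventually_ge_at_top) (auto simp: x1_def)
    have "\<exists>t x. 1 / s t \<le> x \<and> \<epsilon> < R t x \<and> c t > 0 \<and> s t < 1 / x1 \<and> t \<ge> max 0 (real n)" for n
      using frequently_ex[OF frequently_eventually_frequently[OF ex ev[of n]]] by blast
    then obtain t x where tx: "\<And>n. 1 / s (t n) \<le> x n" "\<And>n. \<epsilon> < R (t n) (x n)" "\<And>n. c (t n) > 0"
      "\<And>n. s (t n) < 1 / x1" "\<And>n. t n \<ge> max 0 (real n)"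
      by metis
    have t_nonneg: "t n \<ge> 0" for n using tx(5)[of n] by simp
    have t_lim: "filterlim t at_top sequentially"
      by (rule filterlim_at_top_mono[OF filterlim_real_sequentially]) (use tx(5) in auto)
    have x_gt: "x n > x1" for n
    proof -
      have "x1 < 1 / s (t n)"
        using tx(4)[of n] s_pos[OF t_nonneg, of n] x1_pos by (simp add: field_simps)
      with tx(1)[of n] show ?thesis by linarith
    qed
    have x_pos: "x n > 0" and lx_pos: "l (x n) > 0" for n
      using x_gt[of n] x0[of "x n"] by (auto simp: x1_def)
    have x_lim: "filterlim x at_top sequentially"
    proof (rule filterlim_at_top_mono)
      have "filterlim (\<lambda>n. s (t n)) (at_right 0) sequentially"
        using filterlim_compose[OF s_lim t_lim] s_pos[OF t_nonneg]
        by (auto simp: filterlim_at intro!: always_eventually less_imp_neq[THEN not_sym])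
      from filterlim_compose[OF filterlim_inverse_at_top_right this]
      show "filterlim (\<lambda>n. 1 / s (t n)) at_top sequentially" by (simp add: field_simps)
    qed (use tx in auto)
    define a where "a n = L (t n) (x n) * x n powr (- \<beta>)" for n
    have a_pos: "a n > 0" for n
      using x_pos[of n] lx_pos[of n] tx(3)[of n] by (simp add: a_def L[OF t_nonneg x_pos])
    \<comment> \<open>The transform of \<open>X n\<close> at \<open>k\<close> is that of
      \<open>Z (t n)\<close> at \<open>k / x n\<close>, and \<open>X n > 1\<close> means
      \<open>Z (t n) > x n\<close>.\<close>
    define X where "X n \<omega> = Z (t n) \<omega> / x n" for n \<omega>
    have [measurable]: "Z (t n) \<in> borel_measurable M" for n by (rule Z_meas[OF t_nonneg])
    have X_meas: "X n \<in> borel_measurable M" for n unfolding X_def by measurable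
    have "(\<lambda>n. prob {\<omega> \<in> space M. X n \<omega> > 1} / a n) \<longlonglongrightarrow> 1"
    proof (rule tail_asymptotics_of_laplace[OF assms(2) \<beta> X_meas _ a_pos])
      fix n k :: nat
      interpret D: real_distribution "distr M borel (Z (t n))" by (rule real_distribution_distr) simp
      have "integrable (distr M borel (Z (t n))) (\<lambda>y. exp (- (real k / x n) * y))"
        using assms(5)[OF t_nonneg, of "real k / x n" n] x_pos[of n]
        by (simp add: F[OF t_nonneg] D.interval_measure_cdf)
      then show "integrable M (\<lambda>\<omega>. exp (- real k * X n \<omega>))"
        by (simp add: integrable_distr_eq X_def)
    next
      fix k :: nat assume k: "k > 0"
      \<comment> \<open>By separability \<open>c (t n)\<close> cancels from the ratio of
        \<open>L (t n)\<close> at \<open>x n / k\<close> and at \<open>x n\<close>, so slow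
        variation of the single function \<open>l\<close> suffices although \<open>t n\<close>
        moves.\<close>
      define r where "r n = l (x n / real k) / l (x n)" for n
      define u where "u n = real k / x n" for n
      define e where "e n = E (t n) (u n) / (L (t n) (1 / u n) * u n powr \<beta>)" for n
      have u_pos: "u n > 0" for n using k x_pos[of n] by (simp add: u_def)
      have r_lim: "r \<longlonglongrightarrow> 1"
      proof -
        have "((\<lambda>y. l (1 / real k * y) / l y) \<longlongrightarrow> 1) at_top"
          using l_sv k unfolding slowly_varying_def by (meson of_nat_0_less_iff zero_less_divide_1_iff)
        from filterlim_compose[OF this x_lim] show ?thesis by (simp add: r_def[abs_def])
      qed
      have "filterlim (\<lambda>n. 1 / real k * x n) at_top sequentially"
        by (rule filterlim_tendsto_pos_mult_at_top[OF tendsto_const _ x_lim]) (use k in simp)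
      \<comment> \<open>Division by \<open>k\<close> may bring the argument back below
        \<open>x1\<close>, so positivity is claimed only for large \<open>n\<close>.\<close>
      then have l_ev: "\<forall>\<^sub>F n in sequentially. l (x n / real k) > 0"
        using eventually_compose_filterlim[OF l_pos] by force
      have denom: "L (t n) (1 / u n) * u n powr \<beta> = r n * real k powr \<beta> * a n" for n
        using x_pos[of n] k lx_pos[of n]
        by (simp add: L[OF t_nonneg] a_def u_def r_def powr_divide powr_minus field_simps)
      have denom_ev: "\<forall>\<^sub>F n in sequentially. L (t n) (1 / u n) * u n powr \<beta> > 0"
        using l_ev
      proof eventually_elim
        case (elim n)
        then show ?case using a_pos[of n] lx_pos[of n] k unfolding denom by (simp add: r_def)
      qed
      have e_lim: "e \<longlonglongrightarrow> 0"
      proof -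
        define S where "S t = (SUP u\<in>{0<..real k * s t}. ereal (\<bar>E t u\<bar> / (L t (1 / u) * u powr \<beta>)))" for t
        have "(\<lambda>n. ereal \<bar>e n\<bar>) \<longlonglongrightarrow> 0"
        proof (rule tendsto_sandwich[where f = "\<lambda>_. 0" and h = "\<lambda>n. S (t n)"])
          show "(\<lambda>n. S (t n)) \<longlonglongrightarrow> 0"
            unfolding S_def by (rule filterlim_compose[OF E_lim t_lim]) (use k in simp)
          show "\<forall>\<^sub>F n in sequentially. ereal \<bar>e n\<bar> \<le> S (t n)"
            using denom_ev
          proof eventually_elim
            case (elim n)
            \<comment> \<open>Hence \<open>u n\<close> is at most \<open>k * s (t n)\<close>, and
              the uniform error hypothesis applies with the constant \<open>k\<close>.\<close>
            have "1 / x n \<le> s (t n)"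
              using tx(1)[of n] s_pos[OF t_nonneg, of n] x_pos[of n] by (simp add: field_simps)
            from mult_left_mono[OF this, of "real k"] have "u n \<in> {0<..real k * s (t n)}"
              using u_pos[of n] by (simp add: u_def)
            moreover have "\<bar>e n\<bar> = \<bar>E (t n) (u n)\<bar> / (L (t n) (1 / u n) * u n powr \<beta>)"
              using elim by (simp add: e_def abs_divide)
            ultimately show ?case unfolding S_def by (intro SUP_upper2[of "u n"]) simp_all
          qed
        qed auto
        then have "(\<lambda>n. \<bar>e n\<bar>) \<longlonglongrightarrow> 0" by (simp add: zero_ereal_def)
        then show ?thesis by (rule tendsto_rabs_zero_cancel)
      qed
      \<comment> \<open>This is the expansion at \<open>u n > 0\<close> divided by
        \<open>a n\<close>, with \<open>denom\<close> turning each
        \<open>L (t n) (1 / u n) * u n powr \<beta>\<close> into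
        \<open>r n * real k powr \<beta>\<close>.\<close>
      have "\<forall>\<^sub>F n in sequentially. - Gamma (1 - \<beta>) * (r n * real k powr \<beta>) + e n * (r n * real k powr \<beta>) =
          ((\<integral>\<omega>. exp (- real k * X n \<omega>) \<partial>M) - 1) / a n"
        using denom_ev
      proof eventually_elim
        case (elim n)
        have "(\<integral>\<omega>. exp (- real k * X n \<omega>) \<partial>M) = laplace_stieltjes (F (t n)) (u n)"
          by (simp add: F[OF t_nonneg] laplace_stieltjes_cdf X_def u_def)
        also have "\<dots> - 1 = - Gamma (1 - \<beta>) * (L (t n) (1 / u n) * u n powr \<beta>) + E (t n) (u n)"
          using expansion[OF t_nonneg, of "u n" n] u_pos[of n] by simp
        also have "E (t n) (u n) = e n * (L (t n) (1 / u n) * u n powr \<beta>)"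
          using less_imp_neq[OF elim] u_pos[of n] by (auto simp: e_def)
        finally show ?case
          unfolding denom using a_pos[of n] by (simp add: field_simps)
      qed
      moreover have "(\<lambda>n. - Gamma (1 - \<beta>) * (r n * real k powr \<beta>) + e n * (r n * real k powr \<beta>))
          \<longlonglongrightarrow> - Gamma (1 - \<beta>) * (1 * real k powr \<beta>) + 0 * (1 * real k powr \<beta>)"
        by (intro tendsto_intros r_lim e_lim)
      ultimately show "(\<lambda>n. ((\<integral>\<omega>. exp (- real k * X n \<omega>) \<partial>M) - 1) / a n)
          \<longlonglongrightarrow> - Gamma (1 - \<beta>) * real k powr \<beta>"
        using Lim_transform_eventually by fastforce
    qed
    moreover have "{\<omega> \<in> space M. X n \<omega> > 1} = {\<omega> \<in> space M. Z (t n) \<omega> > x n}" for n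
      using x_pos[of n] by (simp add: X_def field_simps)
    ultimately have "(\<lambda>n. R (t n) (x n)) \<longlonglongrightarrow> \<bar>1 - 1\<bar>"
      unfolding R_def by (intro tendsto_intros) (simp add: a_def)
    then have "\<forall>\<^sub>F n in sequentially. R (t n) (x n) < \<epsilon>"
      using that by (intro order_tendstoD(2)) auto
    then show False using tx(2) by (auto simp: eventually_sequentially dest: less_asym)
  qed
  show ?thesis
    unfolding R_def[symmetric] by (rule SUP_ereal_tendsto_zeroI[OF _ _ key]) (auto simp: R_def)
qed

end
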